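(* Let $q$ be a prime power and let $m\ge 1$ be an integer. For each integer $n\ge 1$ let $U=\mathbb{F}_q^n$, $W=\mathbb{F}_q^m$, let $\mathcal{F}$ be the set of all functions $U\to W$, let $\Gamma$ be the extended-affine group acting on $\mathcal{F}$, and let $\mathcal{F}/\Gamma=\{\Gamma\cdot F: F\in\mathcal{F}\}$ be the set of $\Gamma$-orbits (EA-equivalence classes). Then, as $n\to\infty$ (with $q$ and $m$ fixed), $$\frac{|\mathcal{F}/\Gamma|}{|\mathcal{F}|/|\Gamma|}=1+o(1).$$
   Context: For $V=\mathbb{F}_q^k$, $\mathrm{AGL}(V)$ is the group of affine permutations $x\mapsto Px+a$ with $P\in \mathrm{GL}(k,q)$, $a\in V$; $\mathrm{Hom}(U,W)$ is the space of $\mathbb{F}_q$-linear maps $U\to W$. The extended-affine (EA) group $\Gamma$ has underlying set $\mathrm{AGL}(U)\times\mathrm{AGL}(W)\times\mathrm{Hom}(U,W)$. An element $g=(A_{\rm in},A_{\rm out},L)$, with $A_{\rm in}(x)=Px+a$ and $A_{\rm out}(y)=Qy+b$, acts on $F\in\mathcal{F}$ by $$(g\cdot F)(x)=A_{\rm out}\bigl(F(A_{\rm in}(x))\bigr)+L(x)=Q\,F(Px+a)+Lx+b ,$$ the group law on $\Gamma$ being the one given by composition of these transformations, so that this is a group action. One has $|\Gamma|=|\mathrm{AGL}(U)|\cdot|\mathrm{AGL}(W)|\cdot q^{nm}$ and $|\mathcal{F}|=q^{mq^n}$. The orbit of $F$ is $\Gamma\cdot F=\{g\cdot F: g\in\Gamma\}$.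 *)

theory Defs
  imports
    "Jordan_Normal_Form.Matrix"
    "HOL-Algebra.Group_Action"
    "HOL-Number_Theory.Prime_Powers"
begin

text \<open>
  \<open>V = F^k\<close> is \<^term>\<open>carrier_vec k\<close> over a finite field type. All maps between such spaces
  are extensional functions (\<^const>\<open>undefined\<close> off their domain), so that equality and
  cardinality of sets of maps are the intended ones.
\<close>

definition AGL :: "nat \<Rightarrow> ('a::field vec \<Rightarrow> 'a vec) set" where
  "AGL k = {(\<lambda>x\<in>carrier_vec k. P *\<^sub>v x + a) | P a.
              P \<in> carrier_mat k k \<and> invertible_mat P \<and> a \<in> carrier_vec k}"

definition Hom :: "nat \<Rightarrow> nat \<Rightarrow> ('a::field vec \<Rightarrow> 'a vec) set" where
  "Hom n m = {L \<in> carrier_vec n \<rightarrow>\<^sub>E carrier_vec m.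
              (\<forall>x\<in>carrier_vec n. \<forall>y\<in>carrier_vec n. L (x + y) = L x + L y) \<and>
              (\<forall>c. \<forall>x\<in>carrier_vec n. L (c \<cdot>\<^sub>v x) = c \<cdot>\<^sub>v L x)}"

definition maps :: "nat \<Rightarrow> nat \<Rightarrow> ('a vec \<Rightarrow> 'a vec) set" where
  "maps n m = carrier_vec n \<rightarrow>\<^sub>E carrier_vec m"

type_synonym 'a ea = "('a vec \<Rightarrow> 'a vec) \<times> ('a vec \<Rightarrow> 'a vec) \<times> ('a vec \<Rightarrow> 'a vec)"

definition ea_act :: "nat \<Rightarrow> nat \<Rightarrow> 'a::field ea \<Rightarrow> ('a vec \<Rightarrow> 'a vec) \<Rightarrow> ('a vec \<Rightarrow> 'a vec)" where
  "ea_act n m = (\<lambda>(A, B, L). \<lambda>F\<in>maps n m. \<lambda>x\<in>carrier_vec n. B (F (A x)) + L x)"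

text \<open>
  With \<open>A x = P x + a\<close>, \<open>B y = Q y + b\<close>, expanding \<open>(A, B, L) \<cdot> ((A', B', L') \<cdot> F)\<close> gives
  \<open>Q (B' (F (A' (A x))) + L' (P x + a)) + b + L x\<close>, in which \<open>L' (P x + a) = L' (P x) + L' a\<close>.
  Hence the product has input part \<open>A' \<circ> A\<close>, output part \<open>y \<mapsto> B (B' y + L' a)\<close> and linear part
  \<open>x \<mapsto> L x + Q (L' (P x))\<close>. Below, \<open>a\<close> is written as \<open>A 0\<close>, and \<open>Q (L' (P x))\<close> as the difference
  of \<open>x \<mapsto> B (L' (A x))\<close> and its value at \<open>0\<close>. The theorem \<open>ea_group_action\<close> below confirms that
  this is a group law for which \<open>ea_act\<close> is an action.
\<close>

definition ea_mult :: "nat \<Rightarrow> nat \<Rightarrow> 'a::field ea \<Rightarrow> 'a ea \<Rightarrow> 'a ea" where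
  "ea_mult n m = (\<lambda>(A, B, L) (A', B', L').
     (\<lambda>x\<in>carrier_vec n. A' (A x),
      \<lambda>y\<in>carrier_vec m. B (B' y + L' (A (0\<^sub>v n))),
      \<lambda>x\<in>carrier_vec n. L x + (B (L' (A x)) - B (L' (A (0\<^sub>v n))))))"

definition EA_group :: "nat \<Rightarrow> nat \<Rightarrow> 'a::field ea monoid" where
  "EA_group n m =
     \<lparr>carrier = AGL n \<times> AGL m \<times> Hom n m,
      mult = ea_mult n m,
      one = (\<lambda>x\<in>carrier_vec n. x, \<lambda>y\<in>carrier_vec m. y, \<lambda>x\<in>carrier_vec n. 0\<^sub>v m)\<rparr>"

lemma AGL_E:
  assumes "A \<in> AGL k"
  obtains P a where "P \<in> carrier_mat k k" "invertible_mat P" "a \<in> carrier_vec k"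
    "A = (\<lambda>x\<in>carrier_vec k. P *\<^sub>v x + a)"
  using assms unfolding AGL_def by auto

lemma AGL_I:
  assumes "P \<in> carrier_mat k k" "invertible_mat P" "a \<in> carrier_vec k"
    "A \<in> extensional (carrier_vec k)" "\<And>x. x \<in> carrier_vec k \<Longrightarrow> A x = P *\<^sub>v x + a"
  shows "A \<in> AGL k"
proof -
  have "A = (\<lambda>x\<in>carrier_vec k. P *\<^sub>v x + a)"
    using assms(4,5) by (intro extensionalityI[of A "carrier_vec k"]) auto
  then show ?thesis using assms unfolding AGL_def by blast
qed

lemma AGL_ext: "A \<in> AGL k \<Longrightarrow> A \<in> extensional (carrier_vec k)"
  by (auto elim: AGL_E)

lemma AGL_closed [simp]: "A \<in> AGL k \<Longrightarrow> x \<in> carrier_vec k \<Longrightarrow> A x \<in> carrier_vec k"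
  by (auto elim!: AGL_E)

lemma invertible_mat_obtain:
  fixes P :: "'a::field mat"
  assumes "P \<in> carrier_mat k k" "invertible_mat P"
  obtains R where "R \<in> carrier_mat k k" "P * R = 1\<^sub>m k" "R * P = 1\<^sub>m k"
proof -
  from assms obtain R where R: "P * R = 1\<^sub>m k" "R * P = 1\<^sub>m (dim_row R)"
    unfolding invertible_mat_def inverts_mat_def by auto
  have "dim_col R = k" using arg_cong[OF R(1), of dim_col] by simp
  moreover have "dim_row R = k" using arg_cong[OF R(2), of dim_col] assms(1) by simp
  ultimately show ?thesis using that R by auto
qed

lemma invertible_matI:
  fixes P :: "'a::field mat"
  assumes "P \<in> carrier_mat k k" "R \<in> carrier_mat k k" "P * R = 1\<^sub>m k" "R * P = 1\<^sub>m k"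
  shows "invertible_mat P"
  using assms unfolding invertible_mat_def inverts_mat_def by auto

lemma AGL_add:
  fixes B :: "'a::field vec \<Rightarrow> 'a vec"
  assumes "B \<in> AGL k" "u \<in> carrier_vec k" "v \<in> carrier_vec k"
  shows "B (u + v) = B u + (B v - B (0\<^sub>v k))"
proof -
  from assms(1) obtain Q b where Q: "Q \<in> carrier_mat k k" "b \<in> carrier_vec k"
    "B = (\<lambda>x\<in>carrier_vec k. Q *\<^sub>v x + b)" by (rule AGL_E)
  have "Q *\<^sub>v (u + v) = Q *\<^sub>v u + Q *\<^sub>v v" "Q *\<^sub>v 0\<^sub>v k = 0\<^sub>v k"
    using Q assms by (auto simp: mult_add_distrib_mat_vec)
  moreover have "Q *\<^sub>v u \<in> carrier_vec k" "Q *\<^sub>v v \<in> carrier_vec k" using Q assms by auto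
  ultimately show ?thesis using Q assms by (intro eq_vecI) auto
qed

lemma AGL_id: "(\<lambda>x\<in>carrier_vec k. x) \<in> AGL k"
  by (rule AGL_I[of "1\<^sub>m k" _ "0\<^sub>v k"]) (auto intro: invertible_matI[of _ k "1\<^sub>m k"])

lemma AGL_comp:
  fixes A :: "'a::field vec \<Rightarrow> 'a vec"
  assumes "A \<in> AGL k" "B \<in> AGL k"
  shows "(\<lambda>x\<in>carrier_vec k. B (A x)) \<in> AGL k"
proof -
  from assms(1) obtain P a where P: "P \<in> carrier_mat k k" "invertible_mat P" "a \<in> carrier_vec k"
    "A = (\<lambda>x\<in>carrier_vec k. P *\<^sub>v x + a)" by (rule AGL_E)
  from assms(2) obtain Q b where Q: "Q \<in> carrier_mat k k" "invertible_mat Q" "b \<in> carrier_vec k"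
    "B = (\<lambda>x\<in>carrier_vec k. Q *\<^sub>v x + b)" by (rule AGL_E)
  from invertible_mat_obtain[OF P(1,2)] obtain R where
    R: "R \<in> carrier_mat k k" "P * R = 1\<^sub>m k" "R * P = 1\<^sub>m k" by blast
  from invertible_mat_obtain[OF Q(1,2)] obtain S where
    S: "S \<in> carrier_mat k k" "Q * S = 1\<^sub>m k" "S * Q = 1\<^sub>m k" by blast
  have "(Q * P) * (R * S) = Q * (P * R) * S"
    using P(1) Q(1) R(1) S(1) by (simp add: assoc_mult_mat[where n\<^sub>1=k and n\<^sub>2=k and n\<^sub>3=k and n\<^sub>4=k])
  also have "\<dots> = 1\<^sub>m k" using P Q R S by simp
  finally have 1: "(Q * P) * (R * S) = 1\<^sub>m k" .
  have "(R * S) * (Q * P) = R * (S * Q) * P"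
    using P(1) Q(1) R(1) S(1) by (simp add: assoc_mult_mat[where n\<^sub>1=k and n\<^sub>2=k and n\<^sub>3=k and n\<^sub>4=k])
  also have "\<dots> = 1\<^sub>m k" using P Q R S by simp
  finally have 2: "(R * S) * (Q * P) = 1\<^sub>m k" .
  show ?thesis
  proof (rule AGL_I[of "Q * P" _ "Q *\<^sub>v a + b"])
    show "invertible_mat (Q * P)" using 1 2 P Q R S by (intro invertible_matI[of _ k "R * S"]) auto
    fix x :: "'a vec" assume x: "x \<in> carrier_vec k"
    have "Q *\<^sub>v (P *\<^sub>v x + a) = Q *\<^sub>v (P *\<^sub>v x) + Q *\<^sub>v a"
      using P(1,3) Q(1) x by (intro mult_add_distrib_mat_vec) auto
    then have "B (A x) = (Q *\<^sub>v (P *\<^sub>v x) + Q *\<^sub>v a) + b" using P Q x by simp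
    also have "\<dots> = Q *\<^sub>v (P *\<^sub>v x) + (Q *\<^sub>v a + b)"
      using P Q x by (intro assoc_add_vec[of _ k]) auto
    also have "Q *\<^sub>v (P *\<^sub>v x) = Q * P *\<^sub>v x" using P Q x by simp
    finally show "(\<lambda>x\<in>carrier_vec k. B (A x)) x = Q * P *\<^sub>v x + (Q *\<^sub>v a + b)" using x by simp
  qed (use P Q in auto)
qed

lemma AGL_translation:
  assumes "c \<in> carrier_vec k"
  shows "(\<lambda>x\<in>carrier_vec k. x + c) \<in> AGL k"
  using assms
  by (intro AGL_I[of "1\<^sub>m k" _ c]) (auto intro: invertible_matI[of _ k "1\<^sub>m k"])

lemma AGL_shift:
  fixes B :: "'a::field vec \<Rightarrow> 'a vec"
  assumes "B \<in> AGL k" "c \<in> carrier_vec k"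
  shows "(\<lambda>y\<in>carrier_vec k. B (y + c)) \<in> AGL k"
proof -
  have "(\<lambda>y\<in>carrier_vec k. B (y + c)) =
    (\<lambda>y\<in>carrier_vec k. B ((\<lambda>x\<in>carrier_vec k. x + c) y))" by (rule restrict_ext) simp
  then show ?thesis using AGL_comp[OF AGL_translation[OF assms(2)] assms(1)] by simp
qed

lemma AGL_inverse:
  fixes A :: "'a::field vec \<Rightarrow> 'a vec"
  assumes "A \<in> AGL k"
  obtains A' where "A' \<in> AGL k" "\<And>x. x \<in> carrier_vec k \<Longrightarrow> A (A' x) = x"
    "\<And>x. x \<in> carrier_vec k \<Longrightarrow> A' (A x) = x"
proof -
  from assms(1) obtain P a where P: "P \<in> carrier_mat k k" "invertible_mat P" "a \<in> carrier_vec k"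
    "A = (\<lambda>x\<in>carrier_vec k. P *\<^sub>v x + a)" by (rule AGL_E)
  from invertible_mat_obtain[OF P(1,2)] obtain R where
    R: "R \<in> carrier_mat k k" "P * R = 1\<^sub>m k" "R * P = 1\<^sub>m k" by blast
  define A' where "A' = (\<lambda>x\<in>carrier_vec k. R *\<^sub>v (x + - a))"
  have Rl: "(\<lambda>x\<in>carrier_vec k. R *\<^sub>v x) \<in> AGL k"
    using P R by (intro AGL_I[of R _ "0\<^sub>v k"] invertible_matI[of R k P]) auto
  have "A' = (\<lambda>y\<in>carrier_vec k. (\<lambda>x\<in>carrier_vec k. R *\<^sub>v x) (y + - a))"
    unfolding A'_def using P by (intro restrict_ext) auto
  then have A': "A' \<in> AGL k" using AGL_shift[OF Rl, of "- a"] P by simp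
  show ?thesis
  proof (rule that[OF A'])
    fix x :: "'a vec" assume x: "x \<in> carrier_vec k"
    have "P *\<^sub>v (R *\<^sub>v (x + - a)) = P * R *\<^sub>v (x + - a)"
      using P R x by (intro assoc_mult_mat_vec[symmetric]) auto
    then show "A (A' x) = x" using P R x by (auto simp: A'_def intro!: eq_vecI)
    have e: "P *\<^sub>v x + a + - a = P *\<^sub>v x" using P x by (intro eq_vecI) auto
    have "R *\<^sub>v (P *\<^sub>v x) = R * P *\<^sub>v x"
      using P R x by (intro assoc_mult_mat_vec[symmetric]) auto
    then show "A' (A x) = x" using P R x e by (simp add: A'_def)
  qed
qed

lemma Hom_closed [simp]: "L \<in> Hom n m \<Longrightarrow> x \<in> carrier_vec n \<Longrightarrow> L x \<in> carrier_vec m"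
  by (auto simp: Hom_def)

lemma Hom_ext: "L \<in> Hom n m \<Longrightarrow> L \<in> extensional (carrier_vec n)"
  unfolding Hom_def PiE_def by blast

lemma Hom_add:
  "L \<in> Hom n m \<Longrightarrow> x \<in> carrier_vec n \<Longrightarrow> y \<in> carrier_vec n \<Longrightarrow> L (x + y) = L x + L y"
  unfolding Hom_def by blast

lemma Hom_smult:
  assumes "L \<in> Hom n m" "x \<in> carrier_vec n"
  shows "L (c \<cdot>\<^sub>v x) = c \<cdot>\<^sub>v L x"
proof -
  from assms(1) have "\<forall>c. \<forall>x\<in>carrier_vec n. L (c \<cdot>\<^sub>v x) = c \<cdot>\<^sub>v L x"
    unfolding Hom_def mem_Collect_eq by (elim conjE)
  with assms(2) show ?thesis by (elim allE[of _ c] ballE[of _ _ x]) simp_all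
qed

lemma Hom_zero [simp]:
  assumes "L \<in> Hom n m"
  shows "L (0\<^sub>v n) = 0\<^sub>v m"
proof -
  have "L (0 \<cdot>\<^sub>v 0\<^sub>v n) = 0 \<cdot>\<^sub>v L (0\<^sub>v n)" using assms by (intro Hom_smult) auto
  moreover have "0 \<cdot>\<^sub>v 0\<^sub>v n = (0\<^sub>v n :: 'a vec)" by auto
  moreover have "0 \<cdot>\<^sub>v L (0\<^sub>v n) = 0\<^sub>v m"
    using Hom_closed[OF assms zero_carrier_vec] by (intro eq_vecI) auto
  ultimately show ?thesis by simp
qed

lemma Hom_I:
  assumes "L \<in> extensional (carrier_vec n)"
    and "\<And>x. x \<in> carrier_vec n \<Longrightarrow> L x \<in> carrier_vec m"
    and "\<And>x y. x \<in> carrier_vec n \<Longrightarrow> y \<in> carrier_vec n \<Longrightarrow> L (x + y) = L x + L y"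
    and "\<And>c x. x \<in> carrier_vec n \<Longrightarrow> L (c \<cdot>\<^sub>v x) = c \<cdot>\<^sub>v L x"
  shows "L \<in> Hom n m"
  unfolding Hom_def PiE_def using assms by blast

lemma Hom_plus:
  assumes "L \<in> Hom n m" "M \<in> Hom n m"
  shows "(\<lambda>x\<in>carrier_vec n. L x + M x) \<in> Hom n m"
proof -
  have add: "a + b + (c + d) = a + c + (b + d)"
    if "a \<in> carrier_vec m" "b \<in> carrier_vec m" "c \<in> carrier_vec m" "d \<in> carrier_vec m"
    for a b c d :: "'a vec"
    using that by (intro eq_vecI) auto
  have smult: "c \<cdot>\<^sub>v a + c \<cdot>\<^sub>v b = c \<cdot>\<^sub>v (a + b)"
    if "a \<in> carrier_vec m" "b \<in> carrier_vec m" for a b :: "'a vec" and c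
    using that by (intro eq_vecI) (auto simp: distrib_left)
  show ?thesis
    using assms by (intro Hom_I) (auto simp: Hom_add[OF assms(1)] Hom_add[OF assms(2)]
      Hom_smult[OF assms(1)] Hom_smult[OF assms(2)] add smult)
qed

lemma Hom_uminus:
  assumes "L \<in> Hom n m"
  shows "(\<lambda>x\<in>carrier_vec n. - L x) \<in> Hom n m"
proof -
  have add: "- (a + b) = - a + - b"
    if "a \<in> carrier_vec m" "b \<in> carrier_vec m" for a b :: "'a vec"
    using that by (intro eq_vecI) auto
  have smult: "- (c \<cdot>\<^sub>v a) = c \<cdot>\<^sub>v (- a)" for a :: "'a vec" and c
    by (intro eq_vecI) auto
  show ?thesis
    using assms by (intro Hom_I) (auto simp: Hom_add[OF assms] Hom_smult[OF assms] add smult)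
qed

lemma Hom_null: "(\<lambda>x\<in>carrier_vec n. 0\<^sub>v m) \<in> Hom n m"
  by (auto simp: Hom_def)

lemma Hom_conj:
  fixes A :: "'a::field vec \<Rightarrow> 'a vec"
  assumes "A \<in> AGL n" "B \<in> AGL m" "L \<in> Hom n m"
  shows "(\<lambda>x\<in>carrier_vec n. B (L (A x)) - B (L (A (0\<^sub>v n)))) \<in> Hom n m"
proof -
  from assms(1) obtain P a where P: "P \<in> carrier_mat n n" "a \<in> carrier_vec n"
    "A = (\<lambda>x\<in>carrier_vec n. P *\<^sub>v x + a)" by (rule AGL_E)
  from assms(2) obtain Q b where Q: "Q \<in> carrier_mat m m" "b \<in> carrier_vec m"
    "B = (\<lambda>x\<in>carrier_vec m. Q *\<^sub>v x + b)" by (rule AGL_E)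
  have eq: "B (L (A x)) - B (L (A (0\<^sub>v n))) = Q *\<^sub>v L (P *\<^sub>v x)" if x: "x \<in> carrier_vec n" for x
  proof -
    have "P *\<^sub>v 0\<^sub>v n = 0\<^sub>v n" using P by auto
    then have A0: "A (0\<^sub>v n) = a" using P by simp
    have Px: "P *\<^sub>v x \<in> carrier_vec n" using P x by auto
    have l: "L (P *\<^sub>v x) \<in> carrier_vec m" "L a \<in> carrier_vec m" using assms(3) Px P by auto
    have "L (A x) = L (P *\<^sub>v x) + L a" using Hom_add[OF assms(3) Px P(2)] P x by simp
    then have "B (L (A x)) = Q *\<^sub>v L (P *\<^sub>v x) + Q *\<^sub>v L a + b"
      using Q l by (simp add: mult_add_distrib_mat_vec)
    moreover have "B (L (A (0\<^sub>v n))) = Q *\<^sub>v L a + b" using A0 Q l by simp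
    moreover have "Q *\<^sub>v L (P *\<^sub>v x) \<in> carrier_vec m" "Q *\<^sub>v L a \<in> carrier_vec m"
      using Q l by auto
    moreover have "u + v + b - (v + b) = u"
      if "u \<in> carrier_vec m" "v \<in> carrier_vec m" for u v
      using that Q(2) by (intro eq_vecI) auto
    ultimately show ?thesis by metis
  qed
  have "(\<lambda>x\<in>carrier_vec n. B (L (A x)) - B (L (A (0\<^sub>v n)))) =
        (\<lambda>x\<in>carrier_vec n. Q *\<^sub>v L (P *\<^sub>v x))"
    using eq by (intro restrict_ext) auto
  moreover have "(\<lambda>x\<in>carrier_vec n. Q *\<^sub>v L (P *\<^sub>v x)) \<in> Hom n m"
    unfolding Hom_def
  proof (intro CollectI conjI ballI allI)
    show "(\<lambda>x\<in>carrier_vec n. Q *\<^sub>v L (P *\<^sub>v x)) \<in> carrier_vec n \<rightarrow>\<^sub>E carrier_vec m"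
      using P Q assms by auto
  next
    fix x y :: "'a vec" assume xy: "x \<in> carrier_vec n" "y \<in> carrier_vec n"
    have "P *\<^sub>v (x + y) = P *\<^sub>v x + P *\<^sub>v y" using P xy by (simp add: mult_add_distrib_mat_vec)
    moreover have c: "P *\<^sub>v x \<in> carrier_vec n" "P *\<^sub>v y \<in> carrier_vec n" using P xy by auto
    ultimately have "L (P *\<^sub>v (x + y)) = L (P *\<^sub>v x) + L (P *\<^sub>v y)"
      using Hom_add[OF assms(3)] by simp
    then have "Q *\<^sub>v L (P *\<^sub>v (x + y)) = Q *\<^sub>v L (P *\<^sub>v x) + Q *\<^sub>v L (P *\<^sub>v y)"
      using Q c assms(3) by (simp add: mult_add_distrib_mat_vec)
    then show "(\<lambda>x\<in>carrier_vec n. Q *\<^sub>v L (P *\<^sub>v x)) (x + y) =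
       (\<lambda>x\<in>carrier_vec n. Q *\<^sub>v L (P *\<^sub>v x)) x + (\<lambda>x\<in>carrier_vec n. Q *\<^sub>v L (P *\<^sub>v x)) y"
      using xy by simp
  next
    fix c and x :: "'a vec" assume x: "x \<in> carrier_vec n"
    have c: "P *\<^sub>v x \<in> carrier_vec n" using P x by auto
    have "P *\<^sub>v (c \<cdot>\<^sub>v x) = c \<cdot>\<^sub>v (P *\<^sub>v x)" using P x by (intro mult_mat_vec) auto
    moreover have "L (c \<cdot>\<^sub>v (P *\<^sub>v x)) = c \<cdot>\<^sub>v L (P *\<^sub>v x)"
      using assms(3) c by (rule Hom_smult)
    moreover have "Q *\<^sub>v (c \<cdot>\<^sub>v L (P *\<^sub>v x)) = c \<cdot>\<^sub>v (Q *\<^sub>v L (P *\<^sub>v x))"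
      using Q assms(3) c by (intro mult_mat_vec[of _ m m]) auto
    ultimately show "(\<lambda>x\<in>carrier_vec n. Q *\<^sub>v L (P *\<^sub>v x)) (c \<cdot>\<^sub>v x) =
       c \<cdot>\<^sub>v (\<lambda>x\<in>carrier_vec n. Q *\<^sub>v L (P *\<^sub>v x)) x"
      using x by simp
  qed
  ultimately show ?thesis by simp
qed

lemma ea_mult_closed:
  assumes "g \<in> carrier (EA_group n m)" "h \<in> carrier (EA_group n m)"
  shows "ea_mult n m g h \<in> carrier (EA_group n m)"
proof -
  obtain A B L A' B' L' where gh: "g = (A, B, L)" "h = (A', B', L')" by (metis prod_cases3)
  have h: "A \<in> AGL n" "B \<in> AGL m" "L \<in> Hom n m" "A' \<in> AGL n" "B' \<in> AGL m" "L' \<in> Hom n m"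
    using assms unfolding gh EA_group_def by auto
  have c: "L' (A (0\<^sub>v n)) \<in> carrier_vec m" using h by auto
  have 1: "(\<lambda>x\<in>carrier_vec n. A' (A x)) \<in> AGL n" using AGL_comp h by blast
  have "(\<lambda>y\<in>carrier_vec m. (\<lambda>y\<in>carrier_vec m. B (y + L' (A (0\<^sub>v n)))) (B' y)) \<in> AGL m"
    by (rule AGL_comp[OF h(5) AGL_shift[OF h(2) c]])
  moreover have "(\<lambda>y\<in>carrier_vec m. (\<lambda>y\<in>carrier_vec m. B (y + L' (A (0\<^sub>v n)))) (B' y)) =
     (\<lambda>y\<in>carrier_vec m. B (B' y + L' (A (0\<^sub>v n))))" using h by (intro restrict_ext) auto
  ultimately have 2: "(\<lambda>y\<in>carrier_vec m. B (B' y + L' (A (0\<^sub>v n)))) \<in> AGL m" by simp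
  have "(\<lambda>x\<in>carrier_vec n. L x +
     (\<lambda>x\<in>carrier_vec n. B (L' (A x)) - B (L' (A (0\<^sub>v n)))) x) \<in> Hom n m"
    by (rule Hom_plus[OF h(3) Hom_conj[OF h(1) h(2) h(6)]])
  moreover have "(\<lambda>x\<in>carrier_vec n. L x +
     (\<lambda>x\<in>carrier_vec n. B (L' (A x)) - B (L' (A (0\<^sub>v n)))) x) =
     (\<lambda>x\<in>carrier_vec n. L x + (B (L' (A x)) - B (L' (A (0\<^sub>v n)))))"
    by (intro restrict_ext) auto
  ultimately show ?thesis using 1 2 by (simp add: gh ea_mult_def EA_group_def)
qed

lemma ea_assoc:
  fixes g :: "'a::field ea"
  assumes "g \<in> carrier (EA_group n m)" "h \<in> carrier (EA_group n m)" "k \<in> carrier (EA_group n m)"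
  shows "ea_mult n m (ea_mult n m g h) k = ea_mult n m g (ea_mult n m h k)"
proof -
  obtain A B L A' B' L' A'' B'' L''
    where ghk: "g = (A, B, L)" "h = (A', B', L')" "k = (A'', B'', L'')" by (metis prod_cases3)
  have H: "A \<in> AGL n" "B \<in> AGL m" "L \<in> Hom n m" "A' \<in> AGL n" "B' \<in> AGL m" "L' \<in> Hom n m"
    "A'' \<in> AGL n" "B'' \<in> AGL m" "L'' \<in> Hom n m"
    using assms unfolding ghk EA_group_def by auto
  have B: "B (u + (v - w)) = B u + (B v - B w)"
    if "u \<in> carrier_vec m" "v \<in> carrier_vec m" "w \<in> carrier_vec m" for u v w
  proof -
    have "B (u + (v - w)) = B u + (B (v - w) - B (0\<^sub>v m))"
      using that H by (intro AGL_add) auto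
    moreover have "B ((v - w) + w) = B (v - w) + (B w - B (0\<^sub>v m))"
      using that H by (intro AGL_add) auto
    moreover have "(v - w) + w = v" using that by (intro eq_vecI) auto
    moreover have "B u \<in> carrier_vec m" "B v \<in> carrier_vec m" "B w \<in> carrier_vec m"
      "B (v - w) \<in> carrier_vec m" "B (0\<^sub>v m) \<in> carrier_vec m" using H that by auto
    ultimately show ?thesis by (intro eq_vecI) auto
  qed
  have B': "B' (u + v) = B' u + (B' v - B' (0\<^sub>v m))"
    if "u \<in> carrier_vec m" "v \<in> carrier_vec m" for u v
    using that H by (intro AGL_add) auto
  have out: "B (B' (B'' y + L'' (A' (A (0\<^sub>v n)))) + L' (A (0\<^sub>v n))) =
     B (B' (B'' y + L'' (A' (0\<^sub>v n))) + (L' (A (0\<^sub>v n)) +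
        (B' (L'' (A' (A (0\<^sub>v n)))) - B' (L'' (A' (0\<^sub>v n))))))"
    if y: "y \<in> carrier_vec m" for y
  proof -
    let ?p = "L'' (A' (A (0\<^sub>v n)))" and ?r = "L'' (A' (0\<^sub>v n))" and ?s = "L' (A (0\<^sub>v n))"
    have c: "?p \<in> carrier_vec m" "?r \<in> carrier_vec m" "?s \<in> carrier_vec m" "B'' y \<in> carrier_vec m"
      using H y by auto
    have d: "B' (B'' y) \<in> carrier_vec m" "B' ?p \<in> carrier_vec m" "B' ?r \<in> carrier_vec m"
      "B' (0\<^sub>v m) \<in> carrier_vec m" using H c by auto
    have "B' (B'' y + ?p) + ?s = B' (B'' y + ?r) + (?s + (B' ?p - B' ?r))"
      unfolding B'[OF c(4,1)] B'[OF c(4,2)] using c d by (intro eq_vecI) auto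
    then show ?thesis by simp
  qed
  have lin: "L x + (B (L' (A x)) - B (L' (A (0\<^sub>v n)))) +
      (B (B' (L'' (A' (A x))) + L' (A (0\<^sub>v n))) - B (B' (L'' (A' (A (0\<^sub>v n)))) + L' (A (0\<^sub>v n)))) =
     L x + (B (L' (A x) + (B' (L'' (A' (A x))) - B' (L'' (A' (0\<^sub>v n))))) -
       B (L' (A (0\<^sub>v n)) + (B' (L'' (A' (A (0\<^sub>v n)))) - B' (L'' (A' (0\<^sub>v n))))))"
    if x: "x \<in> carrier_vec n" for x
  proof -
    let ?p = "L' (A x)" and ?s = "L' (A (0\<^sub>v n))" and ?u = "B' (L'' (A' (A x)))"
    let ?v = "B' (L'' (A' (A (0\<^sub>v n))))" and ?w = "B' (L'' (A' (0\<^sub>v n)))"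
    have c: "?p \<in> carrier_vec m" "?s \<in> carrier_vec m" "?u \<in> carrier_vec m"
      "?v \<in> carrier_vec m" "?w \<in> carrier_vec m" "L x \<in> carrier_vec m"
      using H x by auto
    have d: "B ?p \<in> carrier_vec m" "B ?s \<in> carrier_vec m" "B ?u \<in> carrier_vec m"
      "B ?v \<in> carrier_vec m" "B ?w \<in> carrier_vec m" "B (0\<^sub>v m) \<in> carrier_vec m"
      using H c by auto
    have "B (?u + ?s) = B ?u + (B ?s - B (0\<^sub>v m))" "B (?v + ?s) = B ?v + (B ?s - B (0\<^sub>v m))"
      using H c by (auto intro: AGL_add)
    then show ?thesis
      using c d by (simp add: B, intro eq_vecI) auto
  qed
  show ?thesis unfolding ghk ea_mult_def
    using H out lin by (auto intro!: restrict_ext)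
qed

lemma EA_group_group: "group (EA_group n m :: 'a::field ea monoid)"
proof (rule groupI)
  fix g h :: "'a ea"
  assume "g \<in> carrier (EA_group n m)" "h \<in> carrier (EA_group n m)"
  then show "g \<otimes>\<^bsub>EA_group n m\<^esub> h \<in> carrier (EA_group n m)"
    using ea_mult_closed by (simp add: EA_group_def)
next
  show "\<one>\<^bsub>EA_group n m\<^esub> \<in> carrier (EA_group n m)"
    by (simp add: EA_group_def AGL_id Hom_null)
next
  fix g h k :: "'a ea"
  assume "g \<in> carrier (EA_group n m)" "h \<in> carrier (EA_group n m)" "k \<in> carrier (EA_group n m)"
  then show "g \<otimes>\<^bsub>EA_group n m\<^esub> h \<otimes>\<^bsub>EA_group n m\<^esub> k =
    g \<otimes>\<^bsub>EA_group n m\<^esub> (h \<otimes>\<^bsub>EA_group n m\<^esub> k)"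
    using ea_assoc by (simp add: EA_group_def)
next
  fix g :: "'a ea" assume g: "g \<in> carrier (EA_group n m)"
  obtain A B L where gd: "g = (A, B, L)" by (metis prod_cases3)
  have H: "A \<in> AGL n" "B \<in> AGL m" "L \<in> Hom n m" using g by (auto simp: gd EA_group_def)
  show "\<one>\<^bsub>EA_group n m\<^esub> \<otimes>\<^bsub>EA_group n m\<^esub> g = g"
  proof -
    have "(\<lambda>x\<in>carrier_vec n. A ((\<lambda>x\<in>carrier_vec n. x) x)) = A"
      using H AGL_ext by (intro extensionalityI[of _ "carrier_vec n"]) auto
    moreover have "(\<lambda>y\<in>carrier_vec m. (\<lambda>y\<in>carrier_vec m. y) (B y +
        L ((\<lambda>x\<in>carrier_vec n. x) (0\<^sub>v n)))) = B"
      using H AGL_ext by (intro extensionalityI[of _ "carrier_vec m"]) auto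
    moreover have "(\<lambda>x\<in>carrier_vec n. (\<lambda>x\<in>carrier_vec n. 0\<^sub>v m) x +
       ((\<lambda>y\<in>carrier_vec m. y) (L ((\<lambda>x\<in>carrier_vec n. x) x)) -
        (\<lambda>y\<in>carrier_vec m. y) (L ((\<lambda>x\<in>carrier_vec n. x) (0\<^sub>v n))))) = L"
    proof (intro extensionalityI[of _ "carrier_vec n"])
      fix x :: "'a vec" assume x: "x \<in> carrier_vec n"
      then have "L x \<in> carrier_vec m" using H by auto
      then show "(\<lambda>x\<in>carrier_vec n. (\<lambda>x\<in>carrier_vec n. 0\<^sub>v m) x +
       ((\<lambda>y\<in>carrier_vec m. y) (L ((\<lambda>x\<in>carrier_vec n. x) x)) -
        (\<lambda>y\<in>carrier_vec m. y) (L ((\<lambda>x\<in>carrier_vec n. x) (0\<^sub>v n))))) x = L x"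
        using H x by simp
    qed (use H Hom_ext in auto)
    ultimately show ?thesis by (simp add: gd EA_group_def ea_mult_def)
  qed
  from AGL_inverse[OF H(1)] obtain A' where A': "A' \<in> AGL n"
    "\<And>x. x \<in> carrier_vec n \<Longrightarrow> A (A' x) = x" by metis
  from AGL_inverse[OF H(2)] obtain Bi where Bi: "Bi \<in> AGL m"
    "\<And>x. x \<in> carrier_vec m \<Longrightarrow> Bi (B x) = x" by metis
  let ?c = "L (A' (0\<^sub>v n))"
  have c: "?c \<in> carrier_vec m" using H A' by auto
  define B' where "B' = (\<lambda>y\<in>carrier_vec m. Bi (y + - ?c))"
  have B': "B' \<in> AGL m" unfolding B'_def using c by (intro AGL_shift[OF Bi(1)]) auto
  define M where "M = (\<lambda>x\<in>carrier_vec n. B' (L (A' x)) - B' (L (A' (0\<^sub>v n))))"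
  have M: "M \<in> Hom n m" unfolding M_def by (rule Hom_conj[OF A'(1) B' H(3)])
  let ?h = "(A', B', \<lambda>x\<in>carrier_vec n. - M x)"
  have "?h \<in> carrier (EA_group n m)"
    using A' B' Hom_uminus[OF M] by (simp add: EA_group_def)
  moreover have "?h \<otimes>\<^bsub>EA_group n m\<^esub> g = \<one>\<^bsub>EA_group n m\<^esub>"
  proof -
    have 1: "A (A' x) = x" if "x \<in> carrier_vec n" for x using A' that by simp
    have 2: "B' (B y + ?c) = y" if y: "y \<in> carrier_vec m" for y
    proof -
      have By: "B y \<in> carrier_vec m" using H y by auto
      then have "B y + ?c + - ?c = B y" using c by (intro eq_vecI) auto
      then show ?thesis using Bi y By c by (simp add: B'_def)
    qed
    have 3: "- M x + (B' (L (A' x)) - B' (L (A' (0\<^sub>v n)))) = 0\<^sub>v m" if x: "x \<in> carrier_vec n" for x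
    proof -
      have "M x \<in> carrier_vec m" using M x by auto
      then have "- M x + M x = 0\<^sub>v m" by (intro eq_vecI) auto
      then show ?thesis using x by (simp add: M_def)
    qed
    show ?thesis
      by (auto simp: gd EA_group_def ea_mult_def 1 2 3 intro!: restrict_ext)
  qed
  ultimately show "\<exists>h\<in>carrier (EA_group n m). h \<otimes>\<^bsub>EA_group n m\<^esub> g = \<one>\<^bsub>EA_group n m\<^esub>" by blast
qed

lemma ea_act_closed:
  assumes "g \<in> carrier (EA_group n m)" "F \<in> maps n m"
  shows "ea_act n m g F \<in> maps n m"
proof -
  obtain A B L where gd: "g = (A, B, L)" by (metis prod_cases3)
  have H: "A \<in> AGL n" "B \<in> AGL m" "L \<in> Hom n m" using assms by (auto simp: gd EA_group_def)
  have F: "F x \<in> carrier_vec m" if "x \<in> carrier_vec n" for x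
    using assms(2) that by (auto simp: maps_def)
  show ?thesis using H F assms(2) unfolding gd ea_act_def by (auto simp: maps_def)
qed

lemma ea_act_mult:
  assumes "g \<in> carrier (EA_group n m)" "h \<in> carrier (EA_group n m)" "F \<in> maps n m"
  shows "ea_act n m (ea_mult n m g h) F = ea_act n m g (ea_act n m h F)"
proof -
  obtain A B L A' B' L' where gh: "g = (A, B, L)" "h = (A', B', L')" by (metis prod_cases3)
  have H: "A \<in> AGL n" "B \<in> AGL m" "L \<in> Hom n m" "A' \<in> AGL n" "B' \<in> AGL m" "L' \<in> Hom n m"
    using assms unfolding gh EA_group_def by auto
  have F: "F x \<in> carrier_vec m" if "x \<in> carrier_vec n" for x
    using assms(3) that by (auto simp: maps_def)
  have hF: "(\<lambda>x\<in>carrier_vec n. B' (F (A' x)) + L' x) \<in> maps n m"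
    using ea_act_closed[OF assms(2,3)] assms(3) by (simp add: gh ea_act_def)
  have "B (B' (F (A' (A x))) + L' (A (0\<^sub>v n))) + (L x + (B (L' (A x)) - B (L' (A (0\<^sub>v n))))) =
     B (B' (F (A' (A x))) + L' (A x)) + L x" if x: "x \<in> carrier_vec n" for x
  proof -
    let ?y = "B' (F (A' (A x)))"
    have y: "?y \<in> carrier_vec m" "L' (A x) \<in> carrier_vec m" "L' (A (0\<^sub>v n)) \<in> carrier_vec m"
      "L x \<in> carrier_vec m" using H F x by auto
    have c: "B ?y \<in> carrier_vec m" "B (L' (A x)) \<in> carrier_vec m"
      "B (L' (A (0\<^sub>v n))) \<in> carrier_vec m" "B (0\<^sub>v m) \<in> carrier_vec m" using H y by auto
    show ?thesis unfolding AGL_add[OF H(2) y(1,2)] AGL_add[OF H(2) y(1,3)]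
      using c y by (intro eq_vecI) auto
  qed
  then show ?thesis
    using H F hF assms(3) by (auto simp: gh ea_act_def ea_mult_def intro!: restrict_ext)
qed

lemma ea_act_one:
  fixes F :: "'a::field vec \<Rightarrow> 'a vec"
  assumes "F \<in> maps n m"
  shows "ea_act n m \<one>\<^bsub>EA_group n m\<^esub> F = F"
proof (rule extensionalityI[of _ "carrier_vec n"])
  show "F \<in> extensional (carrier_vec n)" using assms by (auto simp: maps_def PiE_def)
  show "ea_act n m \<one>\<^bsub>EA_group n m\<^esub> F \<in> extensional (carrier_vec n)"
    using assms by (simp add: ea_act_def EA_group_def)
  fix x :: "'a vec" assume x: "x \<in> carrier_vec n"
  then have "F x \<in> carrier_vec m" using assms by (auto simp: maps_def)
  then show "ea_act n m \<one>\<^bsub>EA_group n m\<^esub> F x = F x"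
    using assms x by (simp add: ea_act_def EA_group_def)
qed

theorem ea_group_action:
  "group_action (EA_group n m :: 'a::field ea monoid) (maps n m) (ea_act n m)"
proof -
  let ?G = "EA_group n m :: 'a ea monoid"
  interpret G: group ?G by (rule EA_group_group)
  have mult: "g \<otimes>\<^bsub>?G\<^esub> h = ea_mult n m g h" for g h by (simp add: EA_group_def)
  have ext: "ea_act n m g \<in> extensional (maps n m)" for g :: "'a ea"
    by (cases g) (auto simp: ea_act_def)
  have bij: "ea_act n m g \<in> Bij (maps n m)" if g: "g \<in> carrier ?G" for g
  proof -
    have "ea_act n m (inv\<^bsub>?G\<^esub> g) (ea_act n m g F) = F"
      "ea_act n m g (ea_act n m (inv\<^bsub>?G\<^esub> g) F) = F" if F: "F \<in> maps n m" for F
      using ea_act_mult[OF G.inv_closed[OF g] g F] ea_act_mult[OF g G.inv_closed[OF g] F]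
        ea_act_one[OF F] G.l_inv[OF g] G.r_inv[OF g] mult by metis+
    then have "bij_betw (ea_act n m g) (maps n m) (maps n m)"
      using ea_act_closed[OF g] ea_act_closed[OF G.inv_closed[OF g]]
      by (intro bij_betw_byWitness[where f' = "ea_act n m (inv\<^bsub>?G\<^esub> g)"]) auto
    then show ?thesis using ext by (simp add: Bij_def)
  qed
  have "ea_act n m (g \<otimes>\<^bsub>?G\<^esub> h) = compose (maps n m) (ea_act n m g) (ea_act n m h)"
    if "g \<in> carrier ?G" "h \<in> carrier ?G" for g h
    unfolding mult using ext ea_act_mult[OF that]
    by (intro extensionalityI[of _ "maps n m"]) (simp_all add: compose_def)
  then have "ea_act n m \<in> hom ?G (BijGroup (maps n m))"
    using bij by (auto simp: hom_def BijGroup_def)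
  then show ?thesis
    by (intro group_action.intro group_hom.intro group_hom_axioms.intro EA_group_group group_BijGroup)
qed

end

theory Submission
  imports Defs "HOL-Library.Cardinality" "HOL-Real_Asymp.Real_Asymp"
begin

text \<open>
  By Burnside's lemma the quotient is \<open>\<Sum>g. |Fix g| / |F|\<close>, and \<open>g = 1\<close> contributes \<open>1\<close>. For every
  other \<open>g = (A, B, L)\<close> we have \<open>|Fix g| \<le> |F| 2^(- q^n / 6)\<close>, which beats the order
  \<open>q^O(n^2)\<close> of the group. If \<open>A\<close> is not the identity, it moves at least half of the points, so there
  is a set \<open>T\<close> of at least \<open>q^n / 6\<close> points with \<open>A(T)\<close> disjoint from \<open>T\<close>, and a fixed \<open>F\<close> is
  determined by its values off \<open>T\<close> through \<open>F x = B (F (A x)) + L x\<close>. If \<open>A\<close> is the identity,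
  every value \<open>F x\<close> is confined to the solutions \<open>y\<close> of \<open>B y + L x = y\<close>, which are at most half of
  \<open>W\<close> unless \<open>B\<close> is a translation, and then \<open>g\<close> fixes nothing.
\<close>

section \<open>Combinatorial counting tools\<close>

text \<open>A maximal \<open>T\<close> of moved points disjoint from its image works: every moved point then lies in \<open>T\<close>,
  \<open>f ` T\<close> or \<open>f -` T\<close>.\<close>

lemma exists_subset_disjoint_image:
  assumes "finite S" "inj_on f S" "f ` S \<subseteq> S"
  obtains T where "T \<subseteq> S" "T \<inter> f ` T = {}" "card {x\<in>S. f x \<noteq> x} \<le> 3 * card T"
proof -
  define M where "M = {x\<in>S. f x \<noteq> x}"
  define \<T> where "\<T> = {T. T \<subseteq> M \<and> T \<inter> f ` T = {}}"
  have finM: "finite M" using assms(1) by (simp add: M_def)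
  then have "finite \<T>" by (rule finite_subset[rotated, OF finite_Pow_iff[THEN iffD2]]) (auto simp: \<T>_def)
  moreover have "{} \<in> \<T>" by (simp add: \<T>_def)
  ultimately obtain T where T: "T \<in> \<T>" and max: "\<And>T'. T' \<in> \<T> \<Longrightarrow> T \<subseteq> T' \<Longrightarrow> T = T'"
    using finite_has_maximal[of \<T>] by blast
  have TM: "T \<subseteq> M" and disj: "T \<inter> f ` T = {}" using T by (auto simp: \<T>_def)
  have finT: "finite T" using TM finM finite_subset by blast
  let ?P = "{x\<in>S. f x \<in> T}"
  have "x \<in> T \<union> f ` T \<union> ?P" if x: "x \<in> M" for x
  proof (rule ccontr)
    assume nx: "x \<notin> T \<union> f ` T \<union> ?P"
    then have "insert x T \<in> \<T>" using x TM disj unfolding \<T>_def M_def by auto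
    then show False using max[of "insert x T"] nx by auto
  qed
  then have "card M \<le> card (T \<union> f ` T \<union> ?P)"
    using finT assms(1) by (intro card_mono) auto
  also have "\<dots> \<le> card T + card (f ` T) + card ?P"
    by (meson add_le_mono card_Un_le le_refl order_trans)
  also have "card (f ` T) \<le> card T" using finT by (rule card_image_le)
  also have "card ?P \<le> card T"
    by (rule card_inj_on_le[OF _ _ finT]) (auto intro: inj_on_subset[OF assms(2)])
  finally have "card M \<le> 3 * card T" by simp
  moreover have "T \<subseteq> S" using TM by (auto simp: M_def)
  ultimately show thesis using that disj by (simp add: M_def)
qed

text \<open>Restriction to \<open>R\<close> embeds \<open>X\<close> into the functions from
  \<open>R\<close> to \<open>W\<close>. It is applied to linear maps, with \<open>R\<close> the unit
  vectors, and to the functions fixed by a group element, with \<open>R\<close> the complement of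
  the set \<open>T\<close> above.\<close>

lemma card_determined_on_le:
  assumes "X \<subseteq> S \<rightarrow>\<^sub>E W" "finite S" "finite W" "R \<subseteq> S"
    and "\<And>F G. F \<in> X \<Longrightarrow> G \<in> X \<Longrightarrow> \<forall>x\<in>R. F x = G x \<Longrightarrow> F = G"
  shows "card X \<le> card W ^ card R"
proof -
  have finR: "finite R" using assms(2,4) finite_subset by blast
  have "card X \<le> card (R \<rightarrow>\<^sub>E W)"
  proof (rule card_inj_on_le)
    show "inj_on (\<lambda>F. restrict F R) X"
      using assms(5) by (intro inj_onI) (metis restrict_apply')
    show "(\<lambda>F. restrict F R) ` X \<subseteq> R \<rightarrow>\<^sub>E W" using assms(1,4) by fastforce
    show "finite (R \<rightarrow>\<^sub>E W)" using finR assms(3) by (intro finite_PiE) auto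
  qed
  then show ?thesis using finR by (simp add: card_PiE)
qed

section \<open>Sizes of the vector spaces, of the sets of maps and of the EA group\<close>

lemma bij_betw_carrier_vec:
  "bij_betw (vec n) ({..<n} \<rightarrow>\<^sub>E (UNIV :: 'a set)) (carrier_vec n)"
proof (rule bij_betw_byWitness[where f' = "\<lambda>v. \<lambda>i\<in>{..<n}. v $ i"])
  show "\<forall>f\<in>{..<n} \<rightarrow>\<^sub>E (UNIV :: 'a set). (\<lambda>i\<in>{..<n}. vec n f $ i) = f"
    by (auto simp: fun_eq_iff PiE_def extensional_def)
  show "\<forall>v\<in>carrier_vec n. vec n (\<lambda>i\<in>{..<n}. v $ i) = (v :: 'a vec)"
    by (intro ballI eq_vecI) simp_all
  show "vec n ` ({..<n} \<rightarrow>\<^sub>E (UNIV :: 'a set)) \<subseteq> carrier_vec n" by (simp add: image_subset_iff)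
  show "(\<lambda>v. \<lambda>i\<in>{..<n}. v $ i) ` carrier_vec n \<subseteq> {..<n} \<rightarrow>\<^sub>E (UNIV :: 'a set)"
    by (simp add: image_subset_iff)
qed

lemma finite_carrier_vec [simp]: "finite (carrier_vec n :: 'a::finite vec set)"
  using bij_betw_finite[OF bij_betw_carrier_vec[of n, where 'a='a]] by (simp add: finite_PiE)

lemma card_carrier_vec: "card (carrier_vec n :: 'a::finite vec set) = CARD('a) ^ n"
  using bij_betw_same_card[OF bij_betw_carrier_vec[of n, where 'a='a]] by (simp add: card_PiE)

lemma card_maps: "card (maps n m :: ('a::finite vec \<Rightarrow> 'a vec) set) = (CARD('a) ^ m) ^ (CARD('a) ^ n)"
  by (simp add: maps_def card_PiE card_carrier_vec)

lemma finite_maps: "finite (maps n m :: ('a::finite vec \<Rightarrow> 'a vec) set)"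
  unfolding maps_def by (intro finite_PiE) auto

lemma Hom_eqI:
  fixes L M :: "'a::field vec \<Rightarrow> 'a vec"
  assumes L: "L \<in> Hom n m" and M: "M \<in> Hom n m"
    and eq: "\<And>i. i < n \<Longrightarrow> L (unit_vec n i) = M (unit_vec n i)"
  shows "L = M"
proof -
  \<comment> \<open>Induction on a bound \<open>k\<close> for the support of \<open>x\<close>; for
    \<open>k = n\<close> the support condition is vacuous.\<close>
  have main: "L x = M x"
    if "x \<in> carrier_vec n" "\<forall>i<n. i \<ge> k \<longrightarrow> x $ i = 0" "k \<le> n" for k x
    using that
  proof (induction k arbitrary: x)
    case 0
    then have "x = 0\<^sub>v n" by (intro eq_vecI) auto
    then show ?case using L M by simp
  next
    case (Suc k)
    \<comment> \<open>Clearing coordinate \<open>k\<close> brings the support below \<open>k\<close>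
      and splits off a multiple of one unit vector.\<close>
    define y where "y = vec n (\<lambda>i. if i = k then 0 else x $ i)"
    have y: "y \<in> carrier_vec n" by (simp add: y_def)
    have s: "x $ k \<cdot>\<^sub>v unit_vec n k \<in> carrier_vec n" by simp
    have x: "x = y + x $ k \<cdot>\<^sub>v unit_vec n k"
      using Suc.prems by (intro eq_vecI) (auto simp: y_def)
    have "L y = M y"
    proof (rule Suc.IH[OF y])
      show "\<forall>i<n. k \<le> i \<longrightarrow> y $ i = 0" using Suc.prems by (auto simp: y_def)
    qed (use Suc.prems in simp)
    moreover have "L (x $ k \<cdot>\<^sub>v unit_vec n k) = M (x $ k \<cdot>\<^sub>v unit_vec n k)"
      using Hom_smult[OF L unit_vec_carrier] Hom_smult[OF M unit_vec_carrier] eq[of k] Suc.prems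
      by simp
    ultimately show ?case using Hom_add[OF L y s] Hom_add[OF M y s] x by metis
  qed
  show ?thesis
  proof (rule extensionalityI[of _ "carrier_vec n"])
    fix x :: "'a vec" assume "x \<in> carrier_vec n"
    then show "L x = M x" by (intro main[of x n]) auto
  qed (use L M Hom_ext in auto)
qed

lemma finite_Hom: "finite (Hom n m :: ('a::{field,finite} vec \<Rightarrow> 'a vec) set)"
  by (rule finite_subset[OF _ finite_maps[of n m]]) (auto simp: Hom_def maps_def)

lemma card_Hom_le: "card (Hom n m :: ('a::{field,finite} vec \<Rightarrow> 'a vec) set) \<le> CARD('a) ^ (n * m)"
proof -
  let ?U = "unit_vec n ` {..<n} :: 'a vec set"
  have "card (Hom n m :: ('a vec \<Rightarrow> 'a vec) set) \<le> card (carrier_vec m :: 'a vec set) ^ card ?U"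
  proof (rule card_determined_on_le)
    show "Hom n m \<subseteq> carrier_vec n \<rightarrow>\<^sub>E (carrier_vec m :: 'a vec set)" by (auto simp: Hom_def)
    fix F G :: "'a vec \<Rightarrow> 'a vec"
    assume "F \<in> Hom n m" "G \<in> Hom n m" "\<forall>x\<in>?U. F x = G x"
    then show "F = G" by (blast intro: Hom_eqI)
  qed auto
  also have "\<dots> \<le> (CARD('a) ^ m) ^ n"
    unfolding card_carrier_vec
    using card_image_le[of "{..<n}" "unit_vec n :: nat \<Rightarrow> 'a vec"]
    by (intro power_increasing) auto
  finally show ?thesis by (simp add: power_mult [symmetric] mult.commute)
qed

text \<open>Forgetting that \<open>P\<close> is invertible leaves a linear map followed by a
  translation, so \<open>AGL k\<close> inherits finiteness and a size bound from
  \<open>Hom k k\<close>. The overcount is harmless, as only the quadratic growth of the exponent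
  matters.\<close>

lemma AGL_subset_Hom_translates:
  "AGL k \<subseteq> (\<lambda>(L, a). \<lambda>x\<in>carrier_vec k. L x + a) ` (Hom k k \<times> (carrier_vec k :: 'a::field vec set))"
proof
  fix A :: "'a vec \<Rightarrow> 'a vec" assume "A \<in> AGL k"
  then obtain P a where P: "P \<in> carrier_mat k k" "invertible_mat P" "a \<in> carrier_vec k"
    "A = (\<lambda>x\<in>carrier_vec k. P *\<^sub>v x + a)" by (rule AGL_E)
  have "(\<lambda>x\<in>carrier_vec k. P *\<^sub>v x) \<in> Hom k k"
    using P(1) by (intro Hom_I) (auto simp: mult_add_distrib_mat_vec mult_mat_vec)
  moreover have "A = (\<lambda>x\<in>carrier_vec k. (\<lambda>x\<in>carrier_vec k. P *\<^sub>v x) x + a)"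
    unfolding P(4) by (intro restrict_ext) simp
  ultimately show "A \<in> (\<lambda>(L, a). \<lambda>x\<in>carrier_vec k. L x + a) ` (Hom k k \<times> carrier_vec k)"
    using P(3) by (intro image_eqI[of _ _ "(\<lambda>x\<in>carrier_vec k. P *\<^sub>v x, a)"]) auto
qed

lemma finite_AGL: "finite (AGL k :: ('a::{field,finite} vec \<Rightarrow> 'a vec) set)"
  by (rule finite_subset[OF AGL_subset_Hom_translates]) (simp add: finite_Hom)

lemma card_AGL_le: "card (AGL k :: ('a::{field,finite} vec \<Rightarrow> 'a vec) set) \<le> CARD('a) ^ (k * k + k)"
proof -
  have "card (AGL k :: ('a vec \<Rightarrow> 'a vec) set) \<le> card ((Hom k k :: ('a vec \<Rightarrow> 'a vec) set) \<times> (carrier_vec k :: 'a vec set))"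
    by (rule surj_card_le[OF _ AGL_subset_Hom_translates]) (simp add: finite_Hom)
  also have "\<dots> \<le> CARD('a) ^ (k * k) * CARD('a) ^ k"
    using card_Hom_le[of k k, where 'a='a] by (simp add: card_cartesian_product card_carrier_vec)
  finally show ?thesis by (simp add: power_add)
qed

lemma finite_EA_group: "finite (carrier (EA_group n m :: 'a::{field,finite} ea monoid))"
  by (simp add: EA_group_def finite_AGL finite_Hom)

text \<open>The exponent adds up the bounds for \<open>AGL n\<close>, \<open>AGL m\<close> and
  \<open>Hom n m\<close>; for fixed \<open>m\<close> it is quadratic in \<open>n\<close>.\<close>

lemma order_EA_group_le:
  "order (EA_group n m :: 'a::{field,finite} ea monoid) \<le> CARD('a) ^ (n * n + n + (m * m + m) + n * m)"
  unfolding order_def EA_group_def power_add[of _ _ "n * m"] power_add[of _ _ "m * m + m"]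
  by (simp only: partial_object.simps card_cartesian_product mult.assoc)
    (intro mult_le_mono card_AGL_le card_Hom_le)

section \<open>Fixed points of affine maps\<close>

text \<open>
  If \<open>Q d \<noteq> d\<close> for the linear part \<open>Q\<close> of \<open>B\<close>, then translation by \<open>d\<close> maps the solutions of
  \<open>B y + c = y\<close> to non-solutions.
\<close>

lemma card_AGL_solutions_le:
  fixes B :: "'a::{field,finite} vec \<Rightarrow> 'a vec"
  assumes B: "B \<in> AGL k" and d: "d \<in> carrier_vec k" "B d - B (0\<^sub>v k) \<noteq> d" and c: "c \<in> carrier_vec k"
  shows "2 * card {y\<in>carrier_vec k. B y + c = y} \<le> CARD('a) ^ k"
proof -
  let ?V = "carrier_vec k :: 'a vec set"
  let ?E = "{y\<in>?V. B y + c = y}" and ?N = "{y\<in>?V. B y + c \<noteq> y}"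
  have "card ?E \<le> card ?N"
  proof (rule card_inj_on_le[of "\<lambda>y. y + d"])
    show "inj_on (\<lambda>y. y + d) ?E"
    proof (rule inj_onI)
      fix x y assume xy: "x \<in> ?E" "y \<in> ?E" and e: "x + d = y + d"
      have cancel: "z + d - d = z" if "z \<in> ?V" for z
        using that d(1) by (intro eq_vecI) auto
      have "x \<in> ?V" "y \<in> ?V" using xy by auto
      then show "x = y" using e cancel by metis
    qed
    show "(\<lambda>y. y + d) ` ?E \<subseteq> ?N"
    proof clarsimp
      fix y assume y: "y \<in> ?V" "B y + c = y"
      show "y + d \<in> ?V \<and> B (y + d) + c \<noteq> y + d"
      proof
        show "y + d \<in> ?V" using y d by simp
        show "B (y + d) + c \<noteq> y + d"
        proof
          assume h: "B (y + d) + c = y + d"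
          have cl: "B y \<in> ?V" "B d \<in> ?V" "B (0\<^sub>v k) \<in> ?V" using B y d by auto
          have "B (y + d) + c = B y + c + (B d - B (0\<^sub>v k))"
            unfolding AGL_add[OF B y(1) d(1)] using cl c by (intro eq_vecI) auto
          then have e: "y + (B d - B (0\<^sub>v k)) = y + d" using h y by simp
          have cancel: "y + z - y = z" if "z \<in> ?V" for z
            using that y(1) by (intro eq_vecI) auto
          have "B d - B (0\<^sub>v k) \<in> ?V" using cl by simp
          then show False using d e cancel by metis
        qed
      qed
    qed
  qed simp
  moreover have "card ?V = card ?E + card ?N"
    by (subst card_Un_disjoint[symmetric]) (auto intro: arg_cong[where f = card])
  ultimately show ?thesis by (simp add: card_carrier_vec)
qed

lemma AGL_inj_on: "A \<in> AGL k \<Longrightarrow> inj_on A (carrier_vec k)"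
  by (metis AGL_inverse inj_on_inverseI)

text \<open>If the linear part of \<open>A\<close> is not the identity, the preceding bound with
  \<open>c = 0\<close> leaves at most half of the points fixed. Otherwise \<open>A\<close> is
  translation by \<open>A 0\<close>, which is nonzero because \<open>A\<close> is not the identity,
  and no point is fixed.\<close>

lemma card_AGL_moved_ge:
  fixes A :: "'a::{field,finite} vec \<Rightarrow> 'a vec"
  assumes A: "A \<in> AGL k" and "A \<noteq> (\<lambda>x\<in>carrier_vec k. x)"
  shows "CARD('a) ^ k \<le> 2 * card {x\<in>carrier_vec k. A x \<noteq> x}"
proof -
  let ?V = "carrier_vec k :: 'a vec set"
  let ?E = "{x\<in>?V. A x = x}"
  have V: "CARD('a) ^ k = card ?E + card {x\<in>?V. A x \<noteq> x}"
    unfolding card_carrier_vec[symmetric]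
    by (subst card_Un_disjoint[symmetric]) (auto intro: arg_cong[where f = card])
  have "2 * card ?E \<le> CARD('a) ^ k"
  proof (cases "\<exists>d\<in>?V. A d - A (0\<^sub>v k) \<noteq> d")
    case True
    then obtain d where "d \<in> ?V" "A d - A (0\<^sub>v k) \<noteq> d" by blast
    moreover have "?E = {x\<in>?V. A x + 0\<^sub>v k = x}" using A by auto
    ultimately show ?thesis using card_AGL_solutions_le[OF A, of d "0\<^sub>v k"] by simp
  next
    case False
    have tr: "A x = x + A (0\<^sub>v k)" if x: "x \<in> ?V" for x
    proof -
      have "A x \<in> ?V" "A (0\<^sub>v k) \<in> ?V" using A x by auto
      then have "A x = (A x - A (0\<^sub>v k)) + A (0\<^sub>v k)" by (intro eq_vecI) auto
      then show ?thesis using False x by auto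
    qed
    have "A (0\<^sub>v k) = 0\<^sub>v k" if x: "x \<in> ?V" "A x = x" for x
    proof -
      have "A (0\<^sub>v k) \<in> ?V" using A by simp
      then have "A (0\<^sub>v k) = x + A (0\<^sub>v k) - x" using x by (intro eq_vecI) auto
      then show ?thesis using tr[OF x(1)] x by simp
    qed
    moreover have "A (0\<^sub>v k) \<noteq> 0\<^sub>v k"
    proof
      assume A0: "A (0\<^sub>v k) = 0\<^sub>v k"
      have "A x = x" if "x \<in> ?V" for x using tr[OF that] A0 that by simp
      then have "A = (\<lambda>x\<in>?V. x)"
        using AGL_ext[OF A] by (intro extensionalityI[of _ ?V]) auto
      then show False using assms(2) by simp
    qed
    ultimately have "?E = {}" by blast
    then show ?thesis by (simp only: card.empty)
  qed
  then show ?thesis using V by linarith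
qed

section \<open>Functions fixed by a nontrivial group element\<close>

text \<open>Each unit by which the exponent of \<open>W\<close> drops costs a factor of at least 2,
  so losing at least \<open>t\<close> free values costs at least \<open>2 powr t\<close>.\<close>

lemma real_power_le_half_powr:
  fixes K W :: nat and t :: real
  assumes "K \<le> N" "2 \<le> W" "real N - real K \<ge> t"
  shows "real (W ^ K) \<le> real (W ^ N) * 2 powr - t"
proof -
  have "2 powr t \<le> 2 powr real (N - K)" using assms by (intro powr_mono) auto
  also have "\<dots> = 2 ^ (N - K)" by (simp add: powr_realpow)
  also have "\<dots> \<le> real W ^ (N - K)" using assms by (intro power_mono) auto
  finally have "real W ^ K * 2 powr t \<le> real W ^ K * real W ^ (N - K)" by (intro mult_left_mono) auto
  also have "\<dots> = real W ^ N" using assms(1) by (simp add: power_add[symmetric])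
  finally show ?thesis by (simp add: powr_minus field_simps)
qed

lemma ea_act_apply:
  "F \<in> maps n m \<Longrightarrow> x \<in> carrier_vec n \<Longrightarrow> ea_act n m (A, B, L) F x = B (F (A x)) + L x"
  by (simp add: ea_act_def)

lemma card_invariants_input:
  fixes A :: "'a::{field,finite} vec \<Rightarrow> 'a vec"
  assumes A: "A \<in> AGL n" "A \<noteq> (\<lambda>x\<in>carrier_vec n. x)" and "m \<ge> 1"
  shows "real (card (invariants (maps n m) (ea_act n m) (A, B, L)))
    \<le> real (card (maps n m :: ('a vec \<Rightarrow> 'a vec) set)) * 2 powr - (real (CARD('a) ^ n) / 6)"
proof -
  let ?V = "carrier_vec n :: 'a vec set" and ?W = "carrier_vec m :: 'a vec set"
  let ?X = "invariants (maps n m) (ea_act n m) (A, B, L)"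
  have AV: "A ` ?V \<subseteq> ?V" using A(1) by auto
  obtain T where T: "T \<subseteq> ?V" "T \<inter> A ` T = {}" "card {x\<in>?V. A x \<noteq> x} \<le> 3 * card T"
    by (rule exists_subset_disjoint_image[OF finite_carrier_vec AGL_inj_on[OF A(1)] AV])
  have finT: "finite T" using T(1) finite_carrier_vec by (rule finite_subset)
  \<comment> \<open>Ensures that the natural subtraction \<open>CARD('a) ^ n - card T\<close> does
    not truncate.\<close>
  have cT: "card T \<le> CARD('a) ^ n"
    using card_mono[OF _ T(1)] by (simp add: card_carrier_vec)
  have cR: "card (?V - T) = CARD('a) ^ n - card T"
    using T(1) finT by (simp add: card_Diff_subset card_carrier_vec)
  have "card ?X \<le> card ?W ^ card (?V - T)"
  proof (rule card_determined_on_le[of _ ?V])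
    fix F G assume F: "F \<in> ?X" and G: "G \<in> ?X" and eq: "\<forall>x\<in>?V - T. F x = G x"
    have FG: "F \<in> maps n m" "G \<in> maps n m" using F G by (auto simp: invariants_def)
    show "F = G"
    proof (rule extensionalityI[of _ ?V])
      fix x assume x: "x \<in> ?V"
      show "F x = G x"
      proof (cases "x \<in> T")
        case True
        \<comment> \<open>The equation for a fixed function recovers its value at
          \<open>x \<in> T\<close> from its value at \<open>A x\<close>, where \<open>F\<close> and
          \<open>G\<close> already agree.\<close>
        then have "A x \<in> ?V - T" using T(2) A(1) x by auto
        then have "F (A x) = G (A x)" using eq by blast
        moreover have "F x = B (F (A x)) + L x" "G x = B (G (A x)) + L x"
          using F G ea_act_apply[OF FG(1) x, of A B L] ea_act_apply[OF FG(2) x, of A B L]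
          by (auto simp: invariants_def)
        ultimately show ?thesis by simp
      qed (use x eq in blast)
    qed (use FG in \<open>auto simp: maps_def PiE_def\<close>)
  qed (auto simp: invariants_def maps_def)
  then have "real (card ?X) \<le> real ((CARD('a) ^ m) ^ (CARD('a) ^ n - card T))"
    unfolding cR card_carrier_vec by (rule of_nat_mono)
  also have "\<dots> \<le> real ((CARD('a) ^ m) ^ (CARD('a) ^ n)) * 2 powr - (real (CARD('a) ^ n) / 6)"
  proof (rule real_power_le_half_powr)
    \<comment> \<open>A field has distinct elements 0 and 1, and \<open>m \<ge> 1\<close> carries
      this over to \<open>W\<close>: each lost value really saves a factor.\<close>
    have "2 \<le> CARD('a)" using card_mono[of UNIV "{0, 1 :: 'a}"] by simp
    also have "\<dots> \<le> CARD('a) ^ m" using \<open>m \<ge> 1\<close> by (intro self_le_power) auto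
    finally show "2 \<le> CARD('a) ^ m" .
    \<comment> \<open>At least half of the points are moved, and \<open>T\<close> has at least a
      third as many points as are moved.\<close>
    have "CARD('a) ^ n \<le> 6 * card T" using T(3) card_AGL_moved_ge[OF A] by linarith
    then have "real (CARD('a) ^ n) \<le> real (6 * card T)" by (rule of_nat_mono)
    then show "real (CARD('a) ^ n) / 6 \<le> real (CARD('a) ^ n) - real (CARD('a) ^ n - card T)"
      using cT by simp
  qed simp
  finally show ?thesis by (simp add: card_maps)
qed

text \<open>With identity input part, being fixed is a separate condition on each value
  \<open>F x\<close>. If \<open>B\<close> is not a translation, each value loses at least half of
  its choices; if it is, the condition no longer involves \<open>F x\<close> and fails for some
  \<open>x\<close>.\<close>

lemma card_invariants_output:
  fixes B :: "'a::{field,finite} vec \<Rightarrow> 'a vec"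
  assumes B: "B \<in> AGL m" and L: "L \<in> Hom n m"
    and ne: "B \<noteq> (\<lambda>y\<in>carrier_vec m. y) \<or> L \<noteq> (\<lambda>x\<in>carrier_vec n. 0\<^sub>v m)"
  shows "real (card (invariants (maps n m) (ea_act n m) (\<lambda>x\<in>carrier_vec n. x, B, L)))
    \<le> real (card (maps n m :: ('a vec \<Rightarrow> 'a vec) set)) * 2 powr - (real (CARD('a) ^ n) / 6)"
proof -
  let ?V = "carrier_vec n :: 'a vec set" and ?W = "carrier_vec m :: 'a vec set"
  let ?X = "invariants (maps n m) (ea_act n m) (\<lambda>x\<in>carrier_vec n. x, B, L)"
  have X: "F \<in> maps n m" "B (F x) + L x = F x" if "F \<in> ?X" "x \<in> ?V" for F x
    using that ea_act_apply[of F n m x "\<lambda>x\<in>carrier_vec n. x" B L] by (auto simp: invariants_def)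
  show ?thesis
  proof (cases "\<exists>d\<in>?W. B d - B (0\<^sub>v m) \<noteq> d")
    case True
    then obtain d where d: "d \<in> ?W" "B d - B (0\<^sub>v m) \<noteq> d" by blast
    let ?S = "\<lambda>x. {y\<in>?W. B y + L x = y}"
    have "?X \<subseteq> (\<Pi>\<^sub>E x\<in>?V. ?S x)" using X by (fastforce simp: invariants_def maps_def)
    then have "card ?X \<le> card (\<Pi>\<^sub>E x\<in>?V. ?S x)" by (intro card_mono finite_PiE) auto
    then have "real (card ?X) \<le> (\<Prod>x\<in>?V. real (card (?S x)))"
      by (subst (asm) card_PiE) (simp_all flip: of_nat_prod)
    also have "\<dots> \<le> (\<Prod>x\<in>?V. real (CARD('a) ^ m) / 2)"
    proof (rule prod_mono)
      fix x assume "x \<in> ?V"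
      then have "2 * card (?S x) \<le> CARD('a) ^ m"
        using L by (intro card_AGL_solutions_le[OF B d]) auto
      then have "real (2 * card (?S x)) \<le> real (CARD('a) ^ m)" by (rule of_nat_mono)
      then show "0 \<le> real (card (?S x)) \<and> real (card (?S x)) \<le> real (CARD('a) ^ m) / 2" by simp
    qed
    also have "\<dots> = real (card (maps n m :: ('a vec \<Rightarrow> 'a vec) set)) * 2 powr - real (CARD('a) ^ n)"
    proof -
      have half: "(c / 2) ^ N = c ^ N * 2 powr - real N" for c :: real and N :: nat
        by (simp only: divide_inverse power_mult_distrib power_inverse powr_minus powr_realpow[OF zero_less_numeral])
      show ?thesis by (simp only: prod_constant card_maps card_carrier_vec half of_nat_power)
    qed
    \<comment> \<open>The saving here is the full \<open>q^n\<close>; it is weakened to match the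
      bound for nontrivial input parts.\<close>
    also have "\<dots> \<le> real (card (maps n m :: ('a vec \<Rightarrow> 'a vec) set)) * 2 powr - (real (CARD('a) ^ n) / 6)"
      by (intro mult_left_mono powr_mono) auto
    finally show ?thesis .
  next
    case False
    have tr: "B y = y + B (0\<^sub>v m)" if y: "y \<in> ?W" for y
    proof -
      have "B y \<in> ?W" "B (0\<^sub>v m) \<in> ?W" using B y by auto
      then have "B y = (B y - B (0\<^sub>v m)) + B (0\<^sub>v m)" by (intro eq_vecI) auto
      then show ?thesis using False y by auto
    qed
    have "?X = {}"
    proof (rule ccontr)
      assume "?X \<noteq> {}"
      then obtain F where F: "F \<in> ?X" by blast
      have sum0: "B (0\<^sub>v m) + L x = 0\<^sub>v m" if x: "x \<in> ?V" for x
      proof -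
        have Fx: "F x \<in> ?W" using X(1)[OF F x] x by (auto simp: maps_def)
        have cl: "B (0\<^sub>v m) \<in> ?W" "L x \<in> ?W" using B L x by auto
        have "B (0\<^sub>v m) + L x = F x + B (0\<^sub>v m) + L x - F x" using Fx cl by (intro eq_vecI) auto
        also have "\<dots> = F x - F x" using X(2)[OF F x] tr[OF Fx] by simp
        finally show ?thesis using Fx by simp
      qed
      \<comment> \<open>At \<open>x = 0\<close> the linear part vanishes, which isolates the
        translation vector; once it is known to be zero, \<open>L\<close> must vanish
        everywhere.\<close>
      have B0: "B (0\<^sub>v m) = 0\<^sub>v m" using sum0[of "0\<^sub>v n"] L B by simp
      have "B y = y" if "y \<in> ?W" for y using tr[OF that] B0 that by simp
      then have "B = (\<lambda>y\<in>?W. y)"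
        using AGL_ext[OF B] by (intro extensionalityI[of _ ?W]) auto
      moreover have "L = (\<lambda>x\<in>?V. 0\<^sub>v m)"
        using sum0 Hom_ext[OF L] B0 Hom_closed[OF L] by (intro extensionalityI[of _ ?V]) auto
      ultimately show False using ne by blast
    qed
    then show ?thesis by (simp only: card.empty) simp
  qed
qed

lemma card_invariants_le:
  fixes g :: "'a::{field,finite} ea"
  assumes "g \<in> carrier (EA_group n m)" "g \<noteq> \<one>\<^bsub>EA_group n m\<^esub>" "m \<ge> 1"
  shows "real (card (invariants (maps n m) (ea_act n m) g))
    \<le> real (card (maps n m :: ('a vec \<Rightarrow> 'a vec) set)) * 2 powr - (real (CARD('a) ^ n) / 6)"
proof -
  obtain A B L where g: "g = (A, B, L)" by (metis prod_cases3)
  have H: "A \<in> AGL n" "B \<in> AGL m" "L \<in> Hom n m" using assms(1) by (auto simp: g EA_group_def)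
  show ?thesis
  proof (cases "A = (\<lambda>x\<in>carrier_vec n. x)")
    case True
    then show ?thesis
      using card_invariants_output[OF H(2,3)] assms(2) by (simp add: g EA_group_def)
  next
    case False
    then show ?thesis using card_invariants_input[OF H(1)] assms(3) by (simp add: g)
  qed
qed

section \<open>Burnside's lemma and the limit\<close>

lemma orbit_ratio_bounds:
  fixes n m :: nat
  assumes "m \<ge> 1"
  defines "r \<equiv> real (card (orbits (EA_group n m) (maps n m :: ('a::{field,finite} vec \<Rightarrow> 'a vec) set) (ea_act n m))) /
              (real (card (maps n m :: ('a vec \<Rightarrow> 'a vec) set)) /
               real (order (EA_group n m :: 'a ea monoid)))"
  shows "1 \<le> r"
    and "r \<le> 1 + real (order (EA_group n m :: 'a ea monoid)) * 2 powr - (real (CARD('a) ^ n) / 6)"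
proof -
  let ?G = "EA_group n m :: 'a ea monoid" and ?M = "maps n m :: ('a vec \<Rightarrow> 'a vec) set"
  let ?I = "invariants ?M (ea_act n m)"
  let ?e = "2 powr - (real (CARD('a) ^ n) / 6)"
  interpret group_action ?G ?M "ea_act n m" by (rule ea_group_action)
  interpret G: group ?G by (rule EA_group_group)
  have pos: "real (card ?M) > 0" by (simp add: card_maps)
  have "card (orbits ?G ?M (ea_act n m)) * order ?G = (\<Sum>g\<in>carrier ?G. card (?I g))"
    by (rule burnside[OF finite_EA_group finite_maps])
  then have "real (card (orbits ?G ?M (ea_act n m))) * real (order ?G) =
      real (\<Sum>g\<in>carrier ?G. card (?I g))"
    by (simp flip: of_nat_mult)
  also have "\<dots> = real (card (?I \<one>\<^bsub>?G\<^esub>)) + (\<Sum>g\<in>carrier ?G - {\<one>\<^bsub>?G\<^esub>}. real (card (?I g)))"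
    by (simp add: sum.remove[OF finite_EA_group G.one_closed])
  \<comment> \<open>The identity fixes everything and supplies the main term 1; the remaining terms
    are nonnegative, which gives the lower bound.\<close>
  also have "?I \<one>\<^bsub>?G\<^esub> = ?M" using ea_act_one by (auto simp: invariants_def)
  finally have r: "r = 1 + (\<Sum>g\<in>carrier ?G - {\<one>\<^bsub>?G\<^esub>}. real (card (?I g))) / real (card ?M)"
    using pos by (simp add: r_def add_divide_distrib)
  then show "1 \<le> r" by (simp add: sum_nonneg)
  have "(\<Sum>g\<in>carrier ?G - {\<one>\<^bsub>?G\<^esub>}. real (card (?I g))) \<le>
      (\<Sum>g\<in>carrier ?G - {\<one>\<^bsub>?G\<^esub>}. real (card ?M) * ?e)"
    using card_invariants_le[OF _ _ assms(1)] by (intro sum_mono) auto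
  also have "\<dots> = real (card (carrier ?G - {\<one>\<^bsub>?G\<^esub>})) * (real (card ?M) * ?e)" by simp
  also have "\<dots> \<le> real (order ?G) * (real (card ?M) * ?e)"
    unfolding order_def by (intro mult_right_mono of_nat_mono card_mono finite_EA_group) auto
  finally have "(\<Sum>g\<in>carrier ?G - {\<one>\<^bsub>?G\<^esub>}. real (card (?I g))) / real (card ?M) \<le> real (order ?G) * ?e"
    using pos by (simp add: field_simps)
  then show "r \<le> 1 + real (order ?G) * ?e" using r by simp
qed

text \<open>On the logarithmic scale the first factor grows quadratically in \<open>n\<close>, while
  the second decreases like \<open>- q ^ n\<close>, which is exponential because
  \<open>q > 1\<close>.\<close>

lemma order_times_error_tendsto_0:
  fixes q :: real
  assumes "q > 1"
  shows "(\<lambda>n::nat. q ^ (n * n + n + (m * m + m) + n * m) * 2 powr - (q ^ n / 6)) \<longlonglongrightarrow> 0"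
proof -
  \<comment> \<open>Real exponents and a real constant in place of \<open>m\<close> give the form
    that \<open>real_asymp\<close> handles.\<close>
  define c where "c = real m"
  have "(\<lambda>n::nat. q powr (real n * real n + real n + (c * c + c) + real n * c) * 2 powr - (q powr real n / 6)) \<longlonglongrightarrow> 0"
    using assms by real_asymp
  then show ?thesis using assms by (simp add: c_def flip: powr_realpow)
qed

theorem corollary3p7:
  fixes q m :: nat
  assumes "primepow q" and "card (UNIV :: 'a::{field,finite} set) = q" and "m \<ge> 1"
  shows "(\<lambda>n. real (card (orbits (EA_group n m) (maps n m :: ('a vec \<Rightarrow> 'a vec) set) (ea_act n m))) /
              (real (card (maps n m :: ('a vec \<Rightarrow> 'a vec) set)) /
               real (order (EA_group n m :: 'a ea monoid))))
         \<longlonglongrightarrow> 1"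
proof -
  \<comment> \<open>The upper sequence of the sandwich, free of the exact group order; the lower one
    is the constant 1.\<close>
  let ?u = "\<lambda>n::nat. 1 + real q ^ (n * n + n + (m * m + m) + n * m) * 2 powr - (real q ^ n / 6)"
  have "q > 1" using assms(1) by (rule primepow_gt_Suc_0[unfolded One_nat_def[symmetric]])
  then have "(\<lambda>n. real q ^ (n * n + n + (m * m + m) + n * m) * 2 powr - (real q ^ n / 6)) \<longlonglongrightarrow> 0"
    by (intro order_times_error_tendsto_0) simp
  then have lim: "?u \<longlonglongrightarrow> 1" using tendsto_add[OF tendsto_const[of 1]] by fastforce
  have bound: "1 + real (order (EA_group n m :: 'a ea monoid)) * 2 powr - (real (CARD('a) ^ n) / 6) \<le> ?u n" for n
  proof -
    have "order (EA_group n m :: 'a ea monoid) \<le> q ^ (n * n + n + (m * m + m) + n * m)"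
      using order_EA_group_le[of n m, where 'a='a] assms(2) by simp
    then have "real (order (EA_group n m :: 'a ea monoid)) \<le> real (q ^ (n * n + n + (m * m + m) + n * m))"
      by (rule of_nat_mono)
    then show ?thesis using assms(2) by (simp add: mult_right_mono)
  qed
  show ?thesis
    by (rule tendsto_sandwich[OF _ _ tendsto_const lim])
      (intro always_eventually allI orbit_ratio_bounds(1)[OF assms(3)]
        order_trans[OF orbit_ratio_bounds(2)[OF assms(3)] bound])+
qed

end
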